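(* Let $G_0,G_1\in\mathbb{Z}$ with $\gcd(G_0,G_1)=1$, and let $(G_n)_{n\ge0}$ satisfy $G_n=G_{n-1}+G_{n-2}$ for $n\ge2$. If $k$ is a positive integer with $k\equiv 3,9\pmod{12}$ and $\pi_{G_0,G_1}(m)$ is even for all integers $m>2$, then $\mathcal{G}_{G_0,G_1}(k)=2$. In particular, for such $k$, $\mathcal{F}(k)=2$, $\mathcal{L}(k)=2$, and $\mathcal{G}_{G_0,G_1}(k)=2$ whenever $G_1^2-G_0G_1-G_0^2=\pm1$.
   Context: For a positive integer $k$, $\mathcal{G}_{G_0,G_1}(k)$ is the greatest common divisor of all integers $\sum_{i=0}^{k-1}G_{n+i}$, $n\ge1$; $\mathcal{F}(k)$ and $\mathcal{L}(k)$ denote this quantity for the Fibonacci sequence ($G_0=0,G_1=1$) and the Lucas sequence ($G_0=2,G_1=1$). For $m\ge2$, $\pi_{G_0,G_1}(m)$ is the smallest positive integer $r$ with $G_r\equiv G_0$ and $G_{r+1}\equiv G_1 \pmod m$. *)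

theory Defs
  imports "HOL-Number_Theory.Cong"
begin

fun gibonacci :: "int \<Rightarrow> int \<Rightarrow> nat \<Rightarrow> int" where
  "gibonacci a b 0 = a"
| "gibonacci a b (Suc 0) = b"
| "gibonacci a b (Suc (Suc n)) = gibonacci a b (Suc n) + gibonacci a b n"

text \<open>The gcd of the infinite set of sums of \<open>k\<close> consecutive terms. The first term has index
  \<open>n \<ge> 1\<close>; the initial value of index 0 never occurs in a sum.\<close>

definition gib_sum_gcd :: "int \<Rightarrow> int \<Rightarrow> nat \<Rightarrow> int" where
  "gib_sum_gcd a b k = Gcd {\<Sum>i=0..<k. gibonacci a b (n + i) | n. n \<ge> 1}"

abbreviation fib_sum_gcd :: "nat \<Rightarrow> int" where
  "fib_sum_gcd \<equiv> gib_sum_gcd 0 1"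

abbreviation lucas_sum_gcd :: "nat \<Rightarrow> int" where
  "lucas_sum_gcd \<equiv> gib_sum_gcd 2 1"

text \<open>Generalised Pisano period, meant for \<open>m \<ge> 2\<close>. A suitable \<open>r\<close> always exists for such \<open>m\<close>,
  because the recurrence is invertible and there are finitely many pairs of residues.\<close>

definition gib_period :: "int \<Rightarrow> int \<Rightarrow> int \<Rightarrow> nat" where
  "gib_period a b m =
    (LEAST r. r > 0 \<and> [gibonacci a b r = a] (mod m) \<and> [gibonacci a b (r + 1) = b] (mod m))"

end

theory Submission
  imports Defs
begin

text \<open>
  The sum of \<open>k\<close> consecutive terms telescopes to a difference of two terms with indices \<open>k\<close> apart.
  Running the recurrence backwards, an integer \<open>m\<close> divides all these sums iff the sequence
  modulo \<open>m\<close> repeats after \<open>k\<close> steps, that is, iff the period modulo \<open>m\<close> divides \<open>k\<close>. As \<open>k\<close> is an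
  odd multiple of 3, this holds for \<open>m = 2\<close>, and it fails for every \<open>m\<close> whose period is even.
  The quantity \<open>G\<^sub>n\<^sub>+\<^sub>1\<^sup>2 - G\<^sub>n G\<^sub>n\<^sub>+\<^sub>1 - G\<^sub>n\<^sup>2\<close> changes sign at every step, so an odd repetition length
  forces \<open>m\<close> to divide twice its initial value: \<open>\<plusminus>2\<close> in the unimodular case and \<open>-10\<close> for the Lucas
  sequence, whose period modulo 5 is 4.
\<close>

text \<open>Neither positivity nor minimality of \<open>r\<close> is required, so that remainders
  and multiples of repetition lengths can be handled too.\<close>

definition gib_repeats :: "int \<Rightarrow> int \<Rightarrow> int \<Rightarrow> nat \<Rightarrow> bool" where
  "gib_repeats a b m r \<longleftrightarrow> [gibonacci a b r = a] (mod m) \<and> [gibonacci a b (r + 1) = b] (mod m)"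

lemma gib_sum: "(\<Sum>i=0..<k. gibonacci a b (n + i)) = gibonacci a b (n + k + 1) - gibonacci a b (n + 1)"
  by (induction k) auto

lemma gib_repeats_shift:
  assumes "gib_repeats a b m r"
  shows "[gibonacci a b (n + r) = gibonacci a b n] (mod m)"
proof -
  have "[gibonacci a b (n + r) = gibonacci a b n] (mod m) \<and>
        [gibonacci a b (Suc n + r) = gibonacci a b (Suc n)] (mod m)"
  proof (induction n)
    case 0
    then show ?case using assms by (simp add: gib_repeats_def)
  next
    case (Suc n)
    then show ?case by (auto intro: cong_add)
  qed
  then show ?thesis ..
qed

lemma gib_repeats_shift_mult:
  assumes "gib_repeats a b m r"
  shows "[gibonacci a b (n + q * r) = gibonacci a b n] (mod m)"
proof (induction q)
  case (Suc q)
  have "[gibonacci a b (n + Suc q * r) = gibonacci a b (n + q * r)] (mod m)"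
    using gib_repeats_shift[OF assms, of "n + q * r"] by (simp add: add_ac)
  then show ?case using Suc cong_trans by blast
qed simp

lemma gib_repeats_mult: "gib_repeats a b m r \<Longrightarrow> gib_repeats a b m (q * r)"
  using gib_repeats_shift_mult[of a b m r 0 q] gib_repeats_shift_mult[of a b m r 1 q]
  by (simp add: gib_repeats_def)

text \<open>Division with remainder: \<open>k mod p\<close> is again a repetition length, but
  smaller than the least positive one.\<close>

lemma gib_period_dvd:
  assumes "gib_repeats a b m k" "k > 0"
  shows "gib_period a b m dvd k"
proof -
  define p where "p = gib_period a b m"
  have p_Least: "p = (LEAST r. r > 0 \<and> gib_repeats a b m r)"
    by (simp add: p_def gib_period_def gib_repeats_def)
  \<comment> \<open>Here \<open>k\<close> itself witnesses that the set under \<open>LEAST\<close>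
    is nonempty.\<close>
  have p: "p > 0" "gib_repeats a b m p"
    using LeastI[of "\<lambda>r. r > 0 \<and> gib_repeats a b m r" k] assms p_Least by auto
  have "[gibonacci a b (n + k) = gibonacci a b (n + k mod p)] (mod m)" for n
    using gib_repeats_shift_mult[OF p(2), of "n + k mod p" "k div p"] by (simp add: add.assoc)
  from this[of 0] this[of 1] have "gib_repeats a b m (k mod p)"
    using assms(1) by (auto simp: gib_repeats_def intro: cong_trans cong_sym)
  moreover have "k mod p < p"
    using p(1) by simp
  ultimately have "k mod p = 0"
    using not_less_Least[of "k mod p" "\<lambda>r. r > 0 \<and> gib_repeats a b m r"] p_Least by auto
  then show ?thesis by (auto simp: p_def)
qed

lemma dvd_gib_sum_gcd_iff: "m dvd gib_sum_gcd a b k \<longleftrightarrow> gib_repeats a b m k"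
proof
  assume m: "m dvd gib_sum_gcd a b k"
  have S: "m dvd gibonacci a b (n + k + 1) - gibonacci a b (n + 1)" if "n \<ge> 1" for n
  proof -
    have "gib_sum_gcd a b k dvd (\<Sum>i=0..<k. gibonacci a b (n + i))"
      unfolding gib_sum_gcd_def using that by (intro Gcd_dvd) blast
    then show ?thesis using m unfolding gib_sum by (rule dvd_trans[rotated])
  qed
  define G where "G = gibonacci a b"
  have rec: "G (n + 2) = G (n + 1) + G n" for n
    by (simp add: G_def)
  have init: "G 0 = a" "G 1 = b"
    by (simp_all add: G_def)
  \<comment> \<open>Sums start at index 1, so telescoping only reaches differences from index 2 on.
    Two backward steps of the recurrence recover indices 1 and 0.\<close>
  have d2: "m dvd G (k + 2) - G 2" and d3: "m dvd G (k + 3) - G 3"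
    using S[of 1] S[of 2] by (simp_all add: G_def numeral_eq_Suc)
  have "G (k + 1) - G 1 = (G (k + 3) - G 3) - (G (k + 2) - G 2)"
    using rec[of "k + 1"] rec[of 1] by (simp add: numeral_eq_Suc)
  then have d1: "m dvd G (k + 1) - G 1"
    using d2 d3 by simp
  have "G k - G 0 = (G (k + 2) - G 2) - (G (k + 1) - G 1)"
    using rec[of k] rec[of 0] by (simp add: numeral_eq_Suc)
  then have "m dvd G k - G 0"
    using d1 d2 by simp
  with d1 show "gib_repeats a b m k"
    unfolding gib_repeats_def cong_iff_dvd_diff init G_def[symmetric] by simp
next
  assume rep: "gib_repeats a b m k"
  have "m dvd (\<Sum>i=0..<k. gibonacci a b (n + i))" for n
    using gib_repeats_shift[OF rep, of "n + 1"]
    unfolding gib_sum cong_iff_dvd_diff by (simp add: add_ac)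
  then show "m dvd gib_sum_gcd a b k"
    unfolding gib_sum_gcd_def by (auto intro: Gcd_greatest)
qed

text \<open>The gcd is itself a modulus with repetition after \<open>k\<close> steps, so
  \<open>no\<close> applies to it directly.\<close>

lemma gib_sum_gcd_eq_2:
  assumes "3 dvd k" and no: "\<And>m. m > 2 \<Longrightarrow> \<not> gib_repeats a b m k"
  shows "gib_sum_gcd a b k = 2"
proof -
  define g where "g = gib_sum_gcd a b k"
  have g0: "g \<ge> 0"
    by (simp add: g_def gib_sum_gcd_def)
  \<comment> \<open>The terms with indices 3 and 4 are a + 2b and 2a + 3b.\<close>
  have "gib_repeats a b 2 3"
    by (simp add: gib_repeats_def numeral_eq_Suc cong_iff_dvd_diff)
  then have g2: "2 dvd g"
    using gib_repeats_mult[of a b 2 3] \<open>3 dvd k\<close>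
    unfolding g_def dvd_gib_sum_gcd_iff by (metis dvd_div_mult_self)
  \<comment> \<open>Every integer divides 0, so a zero gcd would give repetition modulo 3.\<close>
  have "g \<noteq> 0"
    using no[of 3] dvd_gib_sum_gcd_iff[of 3 a b k] by (auto simp: g_def)
  moreover have "\<not> g > 2"
    using no[of g] dvd_gib_sum_gcd_iff[of g a b k] by (auto simp: g_def)
  ultimately show ?thesis
    using g0 zdvd_imp_le[OF g2] by (simp add: g_def)
qed

text \<open>With \<phi> the golden ratio, the form is the norm of b - a\<phi>. One step of the
  sequence multiplies this element by the unit 1 - \<phi>, whose norm is -1.\<close>

lemma gib_cassini:
  "(gibonacci a b (Suc n))\<^sup>2 - gibonacci a b n * gibonacci a b (Suc n) - (gibonacci a b n)\<^sup>2
     = (- 1) ^ n * (b\<^sup>2 - a * b - a\<^sup>2)"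
proof (induction n)
  case (Suc n)
  have "(gibonacci a b (Suc (Suc n)))\<^sup>2 - gibonacci a b (Suc n) * gibonacci a b (Suc (Suc n))
          - (gibonacci a b (Suc n))\<^sup>2
        = - ((gibonacci a b (Suc n))\<^sup>2 - gibonacci a b n * gibonacci a b (Suc n)
          - (gibonacci a b n)\<^sup>2)"
    by (simp add: power2_eq_square algebra_simps)
  then show ?case using Suc by simp
qed simp

lemma gib_repeats_odd_dvd:
  assumes "gib_repeats a b m k" "odd k"
  shows "m dvd 2 * (b\<^sup>2 - a * b - a\<^sup>2)"
proof -
  have "[(gibonacci a b (Suc k))\<^sup>2 - gibonacci a b k * gibonacci a b (Suc k) - (gibonacci a b k)\<^sup>2
      = b\<^sup>2 - a * b - a\<^sup>2] (mod m)"
    using assms(1) unfolding gib_repeats_def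
    by (intro cong_diff cong_pow cong_mult) simp_all
  then have "[- (b\<^sup>2 - a * b - a\<^sup>2) = b\<^sup>2 - a * b - a\<^sup>2] (mod m)"
    unfolding gib_cassini using \<open>odd k\<close> by simp
  then have "m dvd (b\<^sup>2 - a * b - a\<^sup>2) - - (b\<^sup>2 - a * b - a\<^sup>2)"
    using cong_iff_dvd_diff cong_sym by blast
  then show ?thesis by (simp only: diff_minus_eq_add mult_2)
qed

lemma gib_sum_gcd_unimodular:
  assumes "odd k" "3 dvd k" "\<bar>b\<^sup>2 - a * b - a\<^sup>2\<bar> = 1"
  shows "gib_sum_gcd a b k = 2"
proof (rule gib_sum_gcd_eq_2)
  fix m :: int
  assume "m > 2"
  show "\<not> gib_repeats a b m k"
  proof
    assume "gib_repeats a b m k"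
    then have "m dvd 2 * (b\<^sup>2 - a * b - a\<^sup>2)"
      using \<open>odd k\<close> by (rule gib_repeats_odd_dvd)
    moreover have "\<bar>2 * (b\<^sup>2 - a * b - a\<^sup>2)\<bar> = 2"
      unfolding abs_mult assms(3) by simp
    ultimately have "m dvd 2"
      by (metis dvd_abs_iff)
    then show False
      using \<open>m > 2\<close> zdvd_imp_le[of m 2] by simp
  qed
qed fact

lemma not_lucas_repeats:
  assumes "odd k" "m > 2"
  shows "\<not> gib_repeats 2 1 m k"
proof
  assume rep: "gib_repeats 2 1 m k"
  have m10: "m dvd 10"
    using gib_repeats_odd_dvd[OF rep \<open>odd k\<close>] by (simp add: power2_eq_square)
  \<comment> \<open>A divisor of 10 that exceeds 2 must be 5 or 10.\<close>
  have "5 dvd m"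
  proof (rule ccontr)
    assume "\<not> 5 dvd m"
    moreover have "prime (5 :: int)"
      by simp
    ultimately have "coprime m 5"
      by (metis prime_imp_coprime coprime_commute)
    moreover have "m dvd 2 * 5"
      using m10 by simp
    ultimately have "m dvd 2"
      using coprime_dvd_mult_left_iff by blast
    then show False
      using \<open>m > 2\<close> zdvd_imp_le[of m 2] by simp
  qed
  then have rep5: "gib_repeats 2 1 5 k"
    using rep by (auto simp: gib_repeats_def intro: cong_dvd_modulus)
  \<comment> \<open>Modulo 5 the Lucas numbers run 2, 1, 3, 4, 2, 1, ...; odd indices give only 1
    and 4, never the initial 2.\<close>
  have "gib_repeats 2 1 5 4"
    by (simp add: gib_repeats_def numeral_eq_Suc cong_def)
  from gib_repeats_shift_mult[OF this, of "k mod 4" "k div 4"]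
  have "[gibonacci 2 1 (k mod 4) = 2] (mod 5)"
    using rep5 unfolding gib_repeats_def by (simp add: cong_def)
  moreover have "k mod 4 = 1 \<or> k mod 4 = 3"
    using \<open>odd k\<close> by presburger
  moreover have "gibonacci 2 1 1 = 1" "gibonacci 2 1 3 = 4"
    by (simp_all add: eval_nat_numeral)
  ultimately show False
    by (auto simp: cong_def)
qed

theorem theorem5p5:
  fixes k :: nat
  assumes "k > 0" and "[k = 3] (mod 12) \<or> [k = 9] (mod 12)"
  shows "(\<forall>G0 G1 :: int. gcd G0 G1 = 1 \<longrightarrow> (\<forall>m :: int. m > 2 \<longrightarrow> even (gib_period G0 G1 m)) \<longrightarrow>
            gib_sum_gcd G0 G1 k = 2)
       \<and> fib_sum_gcd k = 2
       \<and> lucas_sum_gcd k = 2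
       \<and> (\<forall>G0 G1 :: int. gcd G0 G1 = 1 \<longrightarrow>
            G1\<^sup>2 - G0 * G1 - G0\<^sup>2 = 1 \<or> G1\<^sup>2 - G0 * G1 - G0\<^sup>2 = - 1 \<longrightarrow>
            gib_sum_gcd G0 G1 k = 2)"
proof -
  have mod12: "k mod 12 = 3 \<or> k mod 12 = 9"
    using assms(2) by (simp add: cong_def)
  have odd: "odd k"
    using mod12 by presburger
  have three: "3 dvd k"
    using mod12 by presburger
  have even_period: "gib_sum_gcd G0 G1 k = 2"
    if "\<forall>m :: int. m > 2 \<longrightarrow> even (gib_period G0 G1 m)" for G0 G1
  proof (rule gib_sum_gcd_eq_2[OF three])
    fix m :: int
    assume "m > 2"
    \<comment> \<open>Otherwise the even period would divide the odd \<open>k\<close>.\<close>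
    then show "\<not> gib_repeats G0 G1 m k"
      using that odd gib_period_dvd[OF _ \<open>k > 0\<close>] dvd_trans by blast
  qed
  have unimodular: "gib_sum_gcd G0 G1 k = 2"
    if "G1\<^sup>2 - G0 * G1 - G0\<^sup>2 = 1 \<or> G1\<^sup>2 - G0 * G1 - G0\<^sup>2 = - 1" for G0 G1
    using that by (intro gib_sum_gcd_unimodular[OF odd three]) auto
  have "fib_sum_gcd k = 2"
    by (rule unimodular) simp
  \<comment> \<open>The invariant is -5 here, so \<open>unimodular\<close> does not apply.\<close>
  moreover have "lucas_sum_gcd k = 2"
    using gib_sum_gcd_eq_2[OF three] not_lucas_repeats[OF odd] by blast
  ultimately show ?thesis
    using even_period unimodular by blast
qed

end
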